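(* Let $(M,\omega)$ be a compact connected quantizable Kähler manifold with very ample quantum line bundle $(L,h)$, and let $s_0,\dots,s_N$ be an orthonormal basis of $\Gamma_{hol}(M,L)$. Let $\phi:L_0\to\mathbb{C}^{N+1}$, $\phi(q)=(\hat q(s_0),\hat q(s_1),\dots,\hat q(s_N))$. Then for all $q,q'\in L_0$ $$\langle e_q,e_{q'}\rangle_L=\langle\phi(q'),\phi(q)\rangle_{\mathbb{C}^{N+1}}.$$
   Context: Quantum line bundle: a holomorphic line bundle $\pi:L\to M$ over the Kähler manifold $(M,\omega)$ with hermitian metric $h$ whose Chern connection has curvature $F=-\mathrm{i}\,\omega$; locally $\omega=-\mathrm{i}\,\partial\bar\partial\log\hat h$. $M$ is quantizable if such a bundle exists. $L$ very ample means that a basis of global holomorphic sections of $L$ defines a holomorphic embedding of $M$ into projective space. All hermitian metrics and scalar products are conjugate linear in the first argument. Scalar product on the space $\Gamma_{hol}(M,L)$ of global holomorphic sections: $\langle\varphi,\psi\rangle_L=\int_M h(\varphi,\psi)\,\Omega$, where $\Omega=\frac{1}{n!}\omega^n$, $n=\dim_{\mathbb{C}}M$, is the (positive) Liouville volume form. $\langle\cdot,\cdot\rangle_{\mathbb{C}^{N+1}}$ is the standard scalar product $\langle u,v\rangle=\sum_j\bar u_jv_j$. Coherent vectors: let $L_0$ be the total space of $L$ minus the zero section. For $q\in L_0$ define a linear form $\hat q$ on $\Gamma_{hol}(M,L)$ by $s(\pi(q))=\hat q(s)\,q$. The coherent vector $e_q\in\Gamma_{hol}(M,L)$ is the unique section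 with $\langle e_q,s\rangle_L=\hat q(s)$ for all $s$. *)

theory Defs
  imports "HOL-Analysis.Analysis"
begin

section \<open>Functions on open subsets of complex coordinate space\<close>

definition cholomorphic_on :: "(complex ^ 'n \<Rightarrow> complex) \<Rightarrow> (complex ^ 'n) set \<Rightarrow> bool" where
  "cholomorphic_on f D \<longleftrightarrow>
     (\<forall>z\<in>D. \<exists>f'. (f has_derivative f') (at z) \<and> (\<forall>c v. f' (c *s v) = c * f' v))"

text \<open>\<open>Ck_on k f D\<close> is only meant for open \<open>D\<close>.\<close>

primrec Ck_on ::
    "nat \<Rightarrow> ('v::real_normed_vector \<Rightarrow> 'w::real_normed_vector) \<Rightarrow> 'v set \<Rightarrow> bool" where
  "Ck_on 0 f D \<longleftrightarrow> continuous_on D f"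
| "Ck_on (Suc k) f D \<longleftrightarrow> (\<forall>z\<in>D. f differentiable (at z)) \<and>
     (\<forall>v. Ck_on k (\<lambda>z. frechet_derivative f (at z) v) D)"

definition smooth_on ::
    "('v::real_normed_vector \<Rightarrow> 'w::real_normed_vector) \<Rightarrow> 'v set \<Rightarrow> bool" where
  "smooth_on f D \<longleftrightarrow> (\<forall>k. Ck_on k f D)"

section \<open>Complex manifolds\<close>

text \<open>The manifold is the whole type \<open>'a\<close>, which is Hausdorff and second countable by its sort;
  its complex structure is given by an atlas.  A chart is a pair \<open>(U, x)\<close>, of which only the
  restriction of \<open>x\<close> to \<open>U\<close> matters.\<close>

type_synonym ('a, 'n) chart = "'a set \<times> ('a \<Rightarrow> complex ^ 'n)"

definition chart_inv :: "('a, 'n) chart \<Rightarrow> complex ^ 'n \<Rightarrow> 'a" where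
  "chart_inv c = inv_into (fst c) (snd c)"

definition transition :: "('a, 'n) chart \<Rightarrow> ('a, 'n) chart \<Rightarrow> complex ^ 'n \<Rightarrow> complex ^ 'n" where
  "transition c d = snd d \<circ> chart_inv c"

definition complex_atlas :: "('a::{t2_space, second_countable_topology}, 'n::finite) chart set \<Rightarrow> bool" where
  "complex_atlas \<A> \<longleftrightarrow>
     (\<Union>c\<in>\<A>. fst c) = UNIV \<and>
     (\<forall>c\<in>\<A>. open (fst c) \<and> open (snd c ` fst c) \<and>
        homeomorphism (fst c) (snd c ` fst c) (snd c) (chart_inv c)) \<and>
     (\<forall>c\<in>\<A>. \<forall>d\<in>\<A>. \<forall>i.
        cholomorphic_on (\<lambda>z. transition c d z $ i) (snd c ` (fst c \<inter> fst d)))"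

definition mholomorphic_on :: "('a, 'n::finite) chart set \<Rightarrow> ('a \<Rightarrow> complex) \<Rightarrow> 'a set \<Rightarrow> bool" where
  "mholomorphic_on \<A> f W \<longleftrightarrow>
     (\<forall>c\<in>\<A>. cholomorphic_on (\<lambda>z. f (chart_inv c z)) (snd c ` (fst c \<inter> W)))"

section \<open>Kaehler forms\<close>

text \<open>A real 2-form is given by its coordinate expressions: \<open>\<omega> c z v w\<close> is its value, in the chart
  \<open>c\<close> and at the point with coordinates \<open>z\<close>, on the tangent vectors with coordinates \<open>v\<close> and \<open>w\<close>.
  The expressions in different charts are related by pullback along the transition maps.\<close>

type_synonym ('a, 'n) two_form =
  "('a, 'n) chart \<Rightarrow> complex ^ 'n \<Rightarrow> complex ^ 'n \<Rightarrow> complex ^ 'n \<Rightarrow> real"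

definition smooth_two_form :: "('a, 'n::finite) chart set \<Rightarrow> ('a, 'n) two_form \<Rightarrow> bool" where
  "smooth_two_form \<A> \<omega> \<longleftrightarrow>
     (\<forall>c\<in>\<A>. \<forall>z\<in>snd c ` fst c. bilinear (\<omega> c z) \<and> (\<forall>v w. \<omega> c z v w = - \<omega> c z w v)) \<and>
     (\<forall>c\<in>\<A>. \<forall>v w. smooth_on (\<lambda>z. \<omega> c z v w) (snd c ` fst c)) \<and>
     (\<forall>c\<in>\<A>. \<forall>d\<in>\<A>. \<forall>z\<in>snd c ` (fst c \<inter> fst d). \<forall>v w.
        \<omega> c z v w =
          \<omega> d (transition c d z)
            (frechet_derivative (transition c d) (at z) v)
            (frechet_derivative (transition c d) (at z) w))"

definition closed_two_form :: "('a, 'n::finite) chart set \<Rightarrow> ('a, 'n) two_form \<Rightarrow> bool" where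
  "closed_two_form \<A> \<omega> \<longleftrightarrow> (\<forall>c\<in>\<A>. \<forall>z\<in>snd c ` fst c. \<forall>u v w.
     frechet_derivative (\<lambda>y. \<omega> c y v w) (at z) u +
     frechet_derivative (\<lambda>y. \<omega> c y w u) (at z) v +
     frechet_derivative (\<lambda>y. \<omega> c y u v) (at z) w = 0)"

text \<open>The last two conjuncts say that \<open>\<omega>\<close> is of type (1,1) and that \<open>\<omega>(v, Jw)\<close>, with \<open>J\<close>
  the multiplication by the imaginary unit, is a Riemannian metric.\<close>

definition kaehler_manifold ::
    "('a::{t2_space, second_countable_topology}, 'n::finite) chart set \<Rightarrow> ('a, 'n) two_form \<Rightarrow> bool" where
  "kaehler_manifold \<A> \<omega> \<longleftrightarrow>
     complex_atlas \<A> \<and> smooth_two_form \<A> \<omega> \<and> closed_two_form \<A> \<omega> \<and>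
     (\<forall>c\<in>\<A>. \<forall>z\<in>snd c ` fst c. \<forall>v w. \<omega> c z (\<i> *s v) (\<i> *s w) = \<omega> c z v w) \<and>
     (\<forall>c\<in>\<A>. \<forall>z\<in>snd c ` fst c. \<forall>v. v \<noteq> 0 \<longrightarrow> \<omega> c z v (\<i> *s v) > 0)"

section \<open>Integration against the Liouville form\<close>

text \<open>The standard real basis of complex coordinate space, ordered in pairs
  \<open>(i, False), (i, True)\<close>, which is positively oriented for the complex orientation.\<close>

definition real_basis :: "'n \<times> bool \<Rightarrow> complex ^ 'n" where
  "real_basis k = axis (fst k) (if snd k then \<i> else 1)"

text \<open>The coefficient of \<open>\<omega>^n / n!\<close> with respect to the coordinate volume form
  \<open>dx\<^sub>1 \<and> dy\<^sub>1 \<and> \<dots> \<and> dx\<^sub>n \<and> dy\<^sub>n\<close>, that is, its value on the basis above.  For a 2-form,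
  \<open>\<omega>^n (v\<^sub>1, \<dots>, v\<^sub>2\<^sub>n)\<close> is \<open>2^(-n)\<close> times the sum over all permutations \<open>p\<close> of
  the sign of \<open>p\<close> times the product of the values of \<open>\<omega>\<close> on the \<open>n\<close> successive pairs of the
  permuted list.\<close>

definition liouville_density :: "(complex ^ 'n::finite \<Rightarrow> complex ^ 'n \<Rightarrow> real) \<Rightarrow> real" where
  "liouville_density \<alpha> =
     (1 / (fact CARD('n) * 2 ^ CARD('n))) *
     (\<Sum>p | p permutes (UNIV :: ('n \<times> bool) set).
        of_int (sign p) *
        (\<Prod>i\<in>UNIV. \<alpha> (real_basis (p (i, False))) (real_basis (p (i, True)))))"

text \<open>Finite partitions of unity subordinate to the atlas; sufficient on compact manifolds.\<close>

definition partition_of_unity ::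
    "('a::topological_space, 'n::finite) chart set \<Rightarrow>
     ('a, 'n) chart set \<times> (('a, 'n) chart \<Rightarrow> 'a \<Rightarrow> real) \<Rightarrow> bool" where
  "partition_of_unity \<A> = (\<lambda>(C, \<rho>).
     finite C \<and> C \<subseteq> \<A> \<and>
     (\<forall>c\<in>C. continuous_on UNIV (\<rho> c) \<and> (\<forall>x. \<rho> c x \<ge> 0) \<and>
        closure {x. \<rho> c x \<noteq> 0} \<subseteq> fst c) \<and>
     (\<forall>x. (\<Sum>c\<in>C. \<rho> c x) = 1))"

text \<open>The integral of \<open>f \<cdot> \<omega>^n / n!\<close> over a compact manifold; by the change of variables formula
  it does not depend on the chosen partition of unity.\<close>

definition liouville_integral ::
    "('a::topological_space, 'n::finite) chart set \<Rightarrow> ('a, 'n) two_form \<Rightarrow> ('a \<Rightarrow> complex) \<Rightarrow> complex" where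
  "liouville_integral \<A> \<omega> f =
     (case (SOME P. partition_of_unity \<A> P) of (C, \<rho>) \<Rightarrow>
        \<Sum>c\<in>C. LINT z : snd c ` fst c | lborel.
          (\<rho> c (chart_inv c z) * liouville_density (\<omega> c z)) *\<^sub>R f (chart_inv c z))"

section \<open>Holomorphic line bundles\<close>

text \<open>The total space is the whole type \<open>'l\<close>.  A local trivialization is a pair \<open>(V, t)\<close> with \<open>V\<close>
  open in the base and \<open>t\<close> the fibre coordinate on the part of the total space over \<open>V\<close>.  Since the
  fibre coordinates are linear bijections from the fibres to the complex numbers, the fibres are
  one-dimensional complex vector spaces.\<close>

record ('a, 'l) line_bundle =
  bproj :: "'l \<Rightarrow> 'a"
  fzero :: "'a \<Rightarrow> 'l"
  fadd :: "'l \<Rightarrow> 'l \<Rightarrow> 'l"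
  fscale :: "complex \<Rightarrow> 'l \<Rightarrow> 'l"
  trivs :: "('a set \<times> ('l \<Rightarrow> complex)) set"

definition fibre :: "('a, 'l) line_bundle \<Rightarrow> 'a \<Rightarrow> 'l set" where
  "fibre L x = {q. bproj L q = x}"

definition holomorphic_line_bundle ::
    "('a::topological_space, 'n::finite) chart set \<Rightarrow> ('a, 'l) line_bundle \<Rightarrow> bool" where
  "holomorphic_line_bundle \<A> L \<longleftrightarrow>
     (\<forall>x. fzero L x \<in> fibre L x) \<and>
     (\<forall>x. \<forall>q\<in>fibre L x. \<forall>r\<in>fibre L x. fadd L q r \<in> fibre L x) \<and>
     (\<forall>x. \<forall>q\<in>fibre L x. \<forall>c. fscale L c q \<in> fibre L x) \<and>
     (\<Union>b\<in>trivs L. fst b) = UNIV \<and>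
     (\<forall>(V, t)\<in>trivs L. open V \<and>
        (\<forall>x\<in>V. bij_betw t (fibre L x) UNIV \<and> t (fzero L x) = 0 \<and>
           (\<forall>q\<in>fibre L x. \<forall>r\<in>fibre L x. t (fadd L q r) = t q + t r) \<and>
           (\<forall>q\<in>fibre L x. \<forall>c. t (fscale L c q) = c * t q))) \<and>
     (\<forall>(V, t)\<in>trivs L. \<forall>(V', t')\<in>trivs L. \<exists>g.
        mholomorphic_on \<A> g (V \<inter> V') \<and>
        (\<forall>x\<in>V \<inter> V'. g x \<noteq> 0 \<and> (\<forall>q\<in>fibre L x. t' q = g x * t q)))"

text \<open>The total space without the zero section.\<close>

definition L0 :: "('a, 'l) line_bundle \<Rightarrow> 'l set" where
  "L0 L = {q. q \<noteq> fzero L (bproj L q)}"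

definition hol_sections ::
    "('a, 'n::finite) chart set \<Rightarrow> ('a, 'l) line_bundle \<Rightarrow> ('a \<Rightarrow> 'l) set" where
  "hol_sections \<A> L =
     {s. (\<forall>x. s x \<in> fibre L x) \<and> (\<forall>(V, t)\<in>trivs L. mholomorphic_on \<A> (\<lambda>x. t (s x)) V)}"

section \<open>Hermitian metrics and quantum line bundles\<close>

text \<open>The local holomorphic frame belonging to a trivialization.\<close>

definition local_frame :: "('a, 'l) line_bundle \<Rightarrow> 'a set \<times> ('l \<Rightarrow> complex) \<Rightarrow> 'a \<Rightarrow> 'l" where
  "local_frame L b x = (THE q. q \<in> fibre L x \<and> snd b q = 1)"

text \<open>The local representative of the metric, \<open>h(e, e)\<close> for the local frame \<open>e\<close>, in coordinates.\<close>

definition local_metric ::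
    "('a, 'l) line_bundle \<Rightarrow> ('l \<Rightarrow> 'l \<Rightarrow> complex) \<Rightarrow> ('a, 'n) chart \<Rightarrow>
     'a set \<times> ('l \<Rightarrow> complex) \<Rightarrow> complex ^ 'n \<Rightarrow> real" where
  "local_metric L h c b z =
     Re (h (local_frame L b (chart_inv c z)) (local_frame L b (chart_inv c z)))"

definition hermitian_metric ::
    "('a, 'n::finite) chart set \<Rightarrow> ('a, 'l) line_bundle \<Rightarrow> ('l \<Rightarrow> 'l \<Rightarrow> complex) \<Rightarrow> bool" where
  "hermitian_metric \<A> L h \<longleftrightarrow>
     (\<forall>x. \<forall>q\<in>fibre L x. \<forall>r\<in>fibre L x. \<forall>r'\<in>fibre L x. h q (fadd L r r') = h q r + h q r') \<and>
     (\<forall>x. \<forall>q\<in>fibre L x. \<forall>r\<in>fibre L x. \<forall>c. h q (fscale L c r) = c * h q r) \<and>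
     (\<forall>x. \<forall>q\<in>fibre L x. \<forall>r\<in>fibre L x. h r q = cnj (h q r)) \<and>
     (\<forall>q\<in>L0 L. Re (h q q) > 0) \<and>
     (\<forall>c\<in>\<A>. \<forall>b\<in>trivs L. smooth_on (local_metric L h c b) (snd c ` (fst c \<inter> fst b)))"

text \<open>The Chern connection is the connection that is compatible with the metric and whose (0,1)-part
  is the Cauchy-Riemann operator of the bundle.  In a local holomorphic frame \<open>e\<close> it is given by
  the 1-form \<open>\<theta>\<close> with \<open>\<nabla>e = \<theta> \<otimes> e\<close>.  With \<open>H = h(e, e)\<close>, the condition on the (0,1)-part says that
  \<open>\<theta>\<close> is of type (1,0), and metric compatibility is \<open>dH(v) = h(\<nabla>\<^sub>v e, e) + h(e, \<nabla>\<^sub>v e)\<close>.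
  The unique solution is \<open>\<theta> = \<partial> log H\<close>.\<close>

definition chern_connection_form ::
    "(complex ^ 'n::finite) set \<Rightarrow> (complex ^ 'n \<Rightarrow> real) \<Rightarrow>
     (complex ^ 'n \<Rightarrow> complex ^ 'n \<Rightarrow> complex) \<Rightarrow> bool" where
  "chern_connection_form D H \<theta> \<longleftrightarrow>
     (\<forall>v. smooth_on (\<lambda>z. \<theta> z v) D) \<and>
     (\<forall>z\<in>D. \<forall>v w. \<theta> z (v + w) = \<theta> z v + \<theta> z w) \<and>
     (\<forall>z\<in>D. \<forall>c v. \<theta> z (c *s v) = c * \<theta> z v) \<and>
     (\<forall>z\<in>D. \<forall>v. complex_of_real (frechet_derivative H (at z) v) =
        (cnj (\<theta> z v) + \<theta> z v) * complex_of_real (H z))"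

text \<open>The curvature of a line bundle connection with local connection form \<open>\<theta>\<close> is \<open>d\<theta>\<close>.\<close>

definition curvature_form ::
    "(complex ^ 'n::finite \<Rightarrow> complex ^ 'n \<Rightarrow> complex) \<Rightarrow>
     complex ^ 'n \<Rightarrow> complex ^ 'n \<Rightarrow> complex ^ 'n \<Rightarrow> complex" where
  "curvature_form \<theta> z v w =
     frechet_derivative (\<lambda>y. \<theta> y w) (at z) v - frechet_derivative (\<lambda>y. \<theta> y v) (at z) w"

definition quantum_line_bundle ::
    "('a::topological_space, 'n::finite) chart set \<Rightarrow> ('a, 'n) two_form \<Rightarrow>
     ('a, 'l) line_bundle \<Rightarrow> ('l \<Rightarrow> 'l \<Rightarrow> complex) \<Rightarrow> bool" where
  "quantum_line_bundle \<A> \<omega> L h \<longleftrightarrow>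
     holomorphic_line_bundle \<A> L \<and> hermitian_metric \<A> L h \<and>
     (\<forall>c\<in>\<A>. \<forall>b\<in>trivs L. \<exists>\<theta>.
        chern_connection_form (snd c ` (fst c \<inter> fst b)) (local_metric L h c b) \<theta> \<and>
        (\<forall>z\<in>snd c ` (fst c \<inter> fst b). \<forall>v w.
           curvature_form \<theta> z v w = - \<i> * complex_of_real (\<omega> c z v w)))"

section \<open>The space of holomorphic sections\<close>

text \<open>\<open>section_comb L c s k\<close> is the linear combination of \<open>s 0, \<dots>, s (k - 1)\<close>.\<close>

primrec section_comb ::
    "('a, 'l) line_bundle \<Rightarrow> (nat \<Rightarrow> complex) \<Rightarrow> (nat \<Rightarrow> 'a \<Rightarrow> 'l) \<Rightarrow> nat \<Rightarrow> 'a \<Rightarrow> 'l" where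
  "section_comb L c s 0 = fzero L"
| "section_comb L c s (Suc k) =
     (\<lambda>x. fadd L (section_comb L c s k x) (fscale L (c k) (s k x)))"

definition section_basis ::
    "('a, 'n::finite) chart set \<Rightarrow> ('a, 'l) line_bundle \<Rightarrow> nat \<Rightarrow> (nat \<Rightarrow> 'a \<Rightarrow> 'l) \<Rightarrow> bool" where
  "section_basis \<A> L N s \<longleftrightarrow>
     (\<forall>j\<le>N. s j \<in> hol_sections \<A> L) \<and>
     (\<forall>t\<in>hol_sections \<A> L. \<exists>c. t = section_comb L c s (Suc N)) \<and>
     (\<forall>c. section_comb L c s (Suc N) = fzero L \<longrightarrow> (\<forall>j\<le>N. c j = 0))"

definition section_inner ::
    "('a::topological_space, 'n::finite) chart set \<Rightarrow> ('a, 'n) two_form \<Rightarrow>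
     ('l \<Rightarrow> 'l \<Rightarrow> complex) \<Rightarrow> ('a \<Rightarrow> 'l) \<Rightarrow> ('a \<Rightarrow> 'l) \<Rightarrow> complex" where
  "section_inner \<A> \<omega> h s t = liouville_integral \<A> \<omega> (\<lambda>x. h (s x) (t x))"

definition orthonormal_section_basis ::
    "('a::topological_space, 'n::finite) chart set \<Rightarrow> ('a, 'n) two_form \<Rightarrow>
     ('a, 'l) line_bundle \<Rightarrow> ('l \<Rightarrow> 'l \<Rightarrow> complex) \<Rightarrow> nat \<Rightarrow> (nat \<Rightarrow> 'a \<Rightarrow> 'l) \<Rightarrow> bool" where
  "orthonormal_section_basis \<A> \<omega> L h N s \<longleftrightarrow>
     section_basis \<A> L N s \<and>
     (\<forall>i\<le>N. \<forall>j\<le>N. section_inner \<A> \<omega> h (s i) (s j) = (if i = j then 1 else 0))"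

text \<open>The linear form \<open>s \<mapsto> hat L q s\<close> for \<open>q \<in> L0 L\<close>.\<close>

definition hat :: "('a, 'l) line_bundle \<Rightarrow> 'l \<Rightarrow> ('a \<Rightarrow> 'l) \<Rightarrow> complex" where
  "hat L q s = (THE c. s (bproj L q) = fscale L c q)"

definition coherent_vector ::
    "('a::topological_space, 'n::finite) chart set \<Rightarrow> ('a, 'n) two_form \<Rightarrow>
     ('a, 'l) line_bundle \<Rightarrow> ('l \<Rightarrow> 'l \<Rightarrow> complex) \<Rightarrow> 'l \<Rightarrow> 'a \<Rightarrow> 'l" where
  "coherent_vector \<A> \<omega> L h q =
     (THE e. e \<in> hol_sections \<A> L \<and>
        (\<forall>s\<in>hol_sections \<A> L. section_inner \<A> \<omega> h e s = hat L q s))"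

section \<open>Projective space and very ample bundles\<close>

text \<open>Vectors with the \<open>N + 1\<close> complex coordinates \<open>0, \<dots>, N\<close> are represented by the functions on
  the natural numbers that vanish above \<open>N\<close>.\<close>

definition cvecs :: "nat \<Rightarrow> (nat \<Rightarrow> complex) set" where
  "cvecs N = {u. \<forall>j>N. u j = 0}"

definition cvec_inner :: "nat \<Rightarrow> (nat \<Rightarrow> complex) \<Rightarrow> (nat \<Rightarrow> complex) \<Rightarrow> complex" where
  "cvec_inner N u v = (\<Sum>j\<le>N. cnj (u j) * v j)"

definition punctured_line :: "(nat \<Rightarrow> complex) \<Rightarrow> (nat \<Rightarrow> complex) set" where
  "punctured_line u = {\<lambda>j. c * u j |c. c \<noteq> 0}"

definition proj_space :: "nat \<Rightarrow> (nat \<Rightarrow> complex) set set" where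
  "proj_space N = punctured_line ` (cvecs N - {\<lambda>_. 0})"

text \<open>The quotient topology.\<close>

definition proj_topology :: "nat \<Rightarrow> (nat \<Rightarrow> complex) set topology" where
  "proj_topology N = topology (\<lambda>S. S \<subseteq> proj_space N \<and>
     openin (top_of_set (cvecs N - {\<lambda>_. 0})) {u \<in> cvecs N - {\<lambda>_. 0}. punctured_line u \<in> S})"

lemma openin_proj_topology:
  "openin (proj_topology N) S \<longleftrightarrow> S \<subseteq> proj_space N \<and>
     openin (top_of_set (cvecs N - {\<lambda>_. 0})) {u \<in> cvecs N - {\<lambda>_. 0}. punctured_line u \<in> S}"
proof -
  let ?T = "top_of_set (cvecs N - {\<lambda>_. 0})"
  let ?P = "\<lambda>S. {u \<in> cvecs N - {\<lambda>_. 0}. punctured_line u \<in> S}"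
  have 1: "?P (S \<inter> T) = ?P S \<inter> ?P T" for S T by auto
  have 2: "?P (\<Union>\<K>) = \<Union>(?P ` \<K>)" for \<K> by auto
  have "istopology (\<lambda>S. S \<subseteq> proj_space N \<and> openin ?T (?P S))"
    unfolding istopology_def 1 2 by (auto intro!: openin_Int openin_Union simp del: openin_Union)
  then show ?thesis
    unfolding proj_topology_def by (simp add: topology_inverse')
qed

text \<open>For a point with homogeneous coordinates \<open>u\<close>, the affine coordinate \<open>u j / u k\<close>, where
  \<open>u k \<noteq> 0\<close>.\<close>

definition affine_coord :: "nat \<Rightarrow> nat \<Rightarrow> (nat \<Rightarrow> complex) set \<Rightarrow> complex" where
  "affine_coord k j p = (THE a. \<exists>u\<in>p. a = u j / u k)"

text \<open>Holomorphic embeddings of a manifold into projective space: topological embeddings that are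
  holomorphic immersions in the affine charts.\<close>

definition projective_embedding ::
    "('a::topological_space, 'n::finite) chart set \<Rightarrow> nat \<Rightarrow> ('a \<Rightarrow> (nat \<Rightarrow> complex) set) \<Rightarrow> bool" where
  "projective_embedding \<A> N \<kappa> \<longleftrightarrow>
     (\<forall>x. \<kappa> x \<in> proj_space N) \<and>
     embedding_map euclidean (proj_topology N) \<kappa> \<and>
     (\<forall>c\<in>\<A>. \<forall>k\<le>N.
        let D = snd c ` {x \<in> fst c. \<forall>u\<in>\<kappa> x. u k \<noteq> 0};
            f = (\<lambda>j z. affine_coord k j (\<kappa> (chart_inv c z)))
        in (\<forall>j\<le>N. cholomorphic_on (f j) D) \<and>
           (\<forall>z\<in>D. \<forall>v. v \<noteq> 0 \<longrightarrow> (\<exists>j\<le>N. frechet_derivative (f j) (at z) v \<noteq> 0)))"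

definition section_coords ::
    "('a, 'l) line_bundle \<Rightarrow> nat \<Rightarrow> (nat \<Rightarrow> 'a \<Rightarrow> 'l) \<Rightarrow> 'l \<Rightarrow> nat \<Rightarrow> complex" where
  "section_coords L N s q = (\<lambda>j. if j \<le> N then hat L q (s j) else 0)"

text \<open>The map \<open>x \<mapsto> (s 0 (x) : \<dots> : s N (x))\<close>.  The coordinate vectors of the sections with respect to
  all nonzero \<open>q\<close> over \<open>x\<close> form one punctured line, or are all zero if \<open>x\<close> is a base point.\<close>

definition section_map ::
    "('a, 'l) line_bundle \<Rightarrow> nat \<Rightarrow> (nat \<Rightarrow> 'a \<Rightarrow> 'l) \<Rightarrow> 'a \<Rightarrow> (nat \<Rightarrow> complex) set" where
  "section_map L N s x = section_coords L N s ` (fibre L x \<inter> L0 L)"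

definition very_ample ::
    "('a::topological_space, 'n::finite) chart set \<Rightarrow> ('a, 'l) line_bundle \<Rightarrow> bool" where
  "very_ample \<A> L \<longleftrightarrow>
     (\<exists>N b. section_basis \<A> L N b \<and> projective_embedding \<A> N (section_map L N b))"

end

theory Submission
  imports Defs
begin

text \<open>Expanding a section in the orthonormal basis shows \<open>e\<^sub>q = \<Sum>\<^sub>j cnj (hat q s\<^sub>j) s\<^sub>j\<close>, and then
  \<open>\<langle>e\<^sub>q, e\<^sub>q'\<rangle> = hat q e\<^sub>q' = \<Sum>\<^sub>j cnj (hat q' s\<^sub>j) hat q s\<^sub>j\<close>.  The analytic content is the
  sesquilinearity of the scalar product: by compactness a partition of unity exists, so the
  integral is a sum of integrals of continuous functions with compact support in the charts.\<close>

section \<open>Partitions of unity on compact manifolds\<close>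

text \<open>A compact Hausdorff space is normal, so Urysohn's lemma separates \<open>p\<close> from
  the complement of \<open>U\<close>. A partition of unity asks for the closed support inside
  \<open>U\<close>, which is more than vanishing off \<open>U\<close>.\<close>

lemma bump_function:
  fixes U :: "'a::t2_space set"
  assumes "compact (UNIV :: 'a set)" "open U" "p \<in> U"
  obtains g :: "'a \<Rightarrow> real" where "continuous_on UNIV g" "\<And>x. g x \<ge> 0" "g p > 0"
    "closure {x. g x \<noteq> 0} \<subseteq> U"
proof -
  have "Hausdorff_space (euclidean :: 'a topology)"
    by (simp add: Hausdorff_space_def disjnt_def) (metis hausdorff)
  then have "normal_space (euclidean :: 'a topology)"
    using assms(1)
    by (intro compact_Hausdorff_or_regular_imp_normal_space) (auto simp: compact_space_def)
  moreover have "disjnt {p} (- U)" using assms(3) by (simp add: disjnt_def)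
  ultimately obtain f :: "'a \<Rightarrow> real" where f: "continuous_map euclidean euclideanreal f"
      "f ` {p} \<subseteq> {1}" "f ` (- U) \<subseteq> {0}"
    using Urysohn_lemma_alt[of euclidean "{p}" "- U"] assms(2) by (metis closed_Compl closed_closedin closed_singleton)
  then have cf: "continuous_on UNIV f" by simp
  show ?thesis
  proof
    \<comment> \<open>Cutting \<open>f\<close> off at level 1/2 keeps the support in the closed set
      where \<open>f\<close> is at least 1/2; this set misses the complement of \<open>U\<close>,
      where \<open>f\<close> is 0.\<close>
    let ?g = "\<lambda>x. max 0 (f x - 1/2)"
    show "continuous_on UNIV ?g" by (intro continuous_intros cf)
    show "?g x \<ge> 0" for x by simp
    show "?g p > 0" using f(2) by simp
    have "closed {x. 1/2 \<le> f x}" by (intro closed_Collect_le continuous_intros cf)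
    then have "closure {x. ?g x \<noteq> 0} \<subseteq> {x. 1/2 \<le> f x}"
      by (intro closure_minimal) (auto simp: max_def split: if_splits)
    also have "\<dots> \<subseteq> U" using f(3) by force
    finally show "closure {x. ?g x \<noteq> 0} \<subseteq> U" .
  qed
qed

text \<open>\<open>liouville_integral\<close> picks its partition by \<open>SOME\<close>, which has
  a meaning only once existence is known. By compactness finitely many bump functions are jointly
  positive everywhere, and dividing by their sum normalises them.\<close>

lemma partition_of_unity_exists:
  fixes \<A> :: "('a::{t2_space, second_countable_topology}, 'n::finite) chart set"
  assumes "compact (UNIV :: 'a set)" "complex_atlas \<A>"
  shows "\<exists>P. partition_of_unity \<A> P"
proof -
  have "\<exists>c\<in>\<A>. p \<in> fst c \<and> open (fst c)" for p
    using assms(2) unfolding complex_atlas_def by blast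
  then obtain ch where ch: "\<And>p. ch p \<in> \<A>" "\<And>p. p \<in> fst (ch p)" "\<And>p. open (fst (ch p))"
    by metis
  have "\<exists>g :: 'a \<Rightarrow> real. continuous_on UNIV g \<and> (\<forall>x. g x \<ge> 0) \<and> g p > 0 \<and>
      closure {x. g x \<noteq> 0} \<subseteq> fst (ch p)" for p
    by (rule bump_function[OF assms(1) ch(3)[of p] ch(2)[of p]]) blast
  then obtain g :: "'a \<Rightarrow> 'a \<Rightarrow> real" where g: "\<And>p. continuous_on UNIV (g p)" "\<And>p x. g p x \<ge> 0"
      "\<And>p. g p p > 0" "\<And>p. closure {x. g p x \<noteq> 0} \<subseteq> fst (ch p)"
    by metis
  have "open {x. 0 < g p x}" for p
    by (intro open_Collect_less continuous_intros g)
  then obtain X where X: "finite X" "UNIV \<subseteq> (\<Union>p\<in>X. {x. 0 < g p x})"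
    by (rule compactE_image[OF assms(1), of UNIV "\<lambda>p. {x. 0 < g p x}"]) (use g(3) in auto)
  define G where "G x = (\<Sum>p\<in>X. g p x)" for x
  \<comment> \<open>Partition functions are indexed by charts, but several points of
    \<open>X\<close> may share a chart, so the bumps are grouped by their chart.\<close>
  define \<rho> where "\<rho> c x = (\<Sum>p\<in>{p\<in>X. ch p = c}. g p x) / G x" for c x
  have Gpos: "G x > 0" for x
  proof -
    obtain p where "p \<in> X" "0 < g p x" using X(2) by blast
    then show ?thesis unfolding G_def using X(1) g(2) by (intro sum_pos2) auto
  qed
  have "partition_of_unity \<A> (ch ` X, \<rho>)"
    unfolding partition_of_unity_def prod.case
  proof (intro conjI ballI allI)
    show "finite (ch ` X)" "ch ` X \<subseteq> \<A>" using X(1) ch(1) by auto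
  next
    fix c
    have "continuous_on UNIV G" unfolding G_def by (intro continuous_intros g)
    moreover have "\<forall>x\<in>UNIV. G x \<noteq> 0" using Gpos by (simp add: less_imp_neq[symmetric])
    ultimately show "continuous_on UNIV (\<rho> c)"
      unfolding \<rho>_def by (intro continuous_intros g)
  next
    fix c x
    show "\<rho> c x \<ge> 0" unfolding \<rho>_def
      using Gpos[of x] by (intro divide_nonneg_pos sum_nonneg g(2))
  next
    fix c
    have "{x. \<rho> c x \<noteq> 0} \<subseteq> (\<Union>p\<in>{p\<in>X. ch p = c}. {x. g p x \<noteq> 0})"
    proof
      fix x assume "x \<in> {x. \<rho> c x \<noteq> 0}"
      then have "(\<Sum>p\<in>{p\<in>X. ch p = c}. g p x) \<noteq> 0" by (auto simp: \<rho>_def)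
      then show "x \<in> (\<Union>p\<in>{p\<in>X. ch p = c}. {x. g p x \<noteq> 0})"
        using sum.not_neutral_contains_not_neutral by blast
    qed
    also have "\<dots> \<subseteq> (\<Union>p\<in>{p\<in>X. ch p = c}. closure {x. g p x \<noteq> 0})"
      by (intro UN_mono closure_subset order_refl)
    finally have "closure {x. \<rho> c x \<noteq> 0} \<subseteq> (\<Union>p\<in>{p\<in>X. ch p = c}. closure {x. g p x \<noteq> 0})"
      using X(1) by (intro closure_minimal closed_UN ballI closed_closure) simp_all
    then show "closure {x. \<rho> c x \<noteq> 0} \<subseteq> fst c" using g(4) by blast
  next
    fix x
    have "(\<Sum>c\<in>ch ` X. \<rho> c x) = (\<Sum>c\<in>ch ` X. \<Sum>p\<in>{p\<in>X. ch p = c}. g p x) / G x"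
      unfolding \<rho>_def by (simp add: sum_divide_distrib)
    also have "(\<Sum>c\<in>ch ` X. \<Sum>p\<in>{p\<in>X. ch p = c}. g p x) = G x"
      unfolding G_def by (rule sum.image_gen[OF X(1), symmetric])
    finally show "(\<Sum>c\<in>ch ` X. \<rho> c x) = 1" using Gpos[of x] by simp
  qed
  then show ?thesis by blast
qed

section \<open>Linearity of the Liouville integral\<close>

text \<open>The density is a polynomial in the coefficients of the form, whose continuity is the
  order-0 part of their smoothness.\<close>

lemma continuous_on_liouville_density:
  fixes \<A> :: "('a::{t2_space, second_countable_topology}, 'n::finite) chart set"
  assumes "smooth_two_form \<A> \<omega>" "c \<in> \<A>"
  shows "continuous_on (snd c ` fst c) (\<lambda>z. liouville_density (\<omega> c z))"
proof -
  have "continuous_on (snd c ` fst c) (\<lambda>z. \<omega> c z v w)" for v w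
  proof -
    have "Ck_on 0 (\<lambda>z. \<omega> c z v w) (snd c ` fst c)"
      using assms unfolding smooth_two_form_def smooth_on_def by blast
    then show ?thesis by simp
  qed
  then show ?thesis unfolding liouville_density_def by (intro continuous_intros)
qed

text \<open>The coordinate domain need not be compact, and the density may be unbounded on it. The
  weight \<open>\<rho> c\<close>, however, has compact support in the chart, so the integrand is
  continuous and vanishes off the compact coordinate image of that support.\<close>

lemma liouville_integrand_integrable:
  fixes \<A> :: "('a::{t2_space, second_countable_topology}, 'n::finite) chart set"
    and f :: "'a \<Rightarrow> complex"
  assumes "compact (UNIV :: 'a set)" "complex_atlas \<A>" "smooth_two_form \<A> \<omega>"
    and "partition_of_unity \<A> (C, \<rho>)" "c \<in> C" "continuous_on UNIV f"
  shows "set_integrable lborel (snd c ` fst c)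
    (\<lambda>z. (\<rho> c (chart_inv c z) * liouville_density (\<omega> c z)) *\<^sub>R f (chart_inv c z))"
    (is "set_integrable _ ?D ?F")
proof -
  have c: "c \<in> \<A>" and \<rho>: "continuous_on UNIV (\<rho> c)" "closure {x. \<rho> c x \<noteq> 0} \<subseteq> fst c"
    using assms(4,5) unfolding partition_of_unity_def by auto
  have hom: "homeomorphism (fst c) ?D (snd c) (chart_inv c)"
    using assms(2) c unfolding complex_atlas_def by blast
  define K where "K = snd c ` closure {x. \<rho> c x \<noteq> 0}"
  have "compact (closure {x. \<rho> c x \<noteq> 0})"
    using assms(1) compact_Int_closed[of UNIV "closure {x. \<rho> c x \<noteq> 0}"] by simp
  then have K: "compact K" "K \<subseteq> ?D"
    unfolding K_def using \<rho>(2) hom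
    by (auto intro!: compact_continuous_image simp: homeomorphism_def intro: continuous_on_subset)
  have "continuous_on ?D ?F"
    using hom continuous_on_liouville_density[OF assms(3) c]
    by (auto intro!: continuous_intros continuous_on_compose2[OF \<rho>(1)]
        continuous_on_compose2[OF assms(6)] simp: homeomorphism_def)
  then have "continuous_on K ?F" using K(2) continuous_on_subset by blast
  with K(1) have "integrable lborel (\<lambda>z. indicator K z *\<^sub>R ?F z)"
    by (rule borel_integrable_compact)
  \<comment> \<open>Between \<open>K\<close> and \<open>?D\<close> the weight is zero; elsewhere the
    two indicators agree because \<open>K\<close> lies in \<open>?D\<close>.\<close>
  moreover have "indicator K z *\<^sub>R ?F z = indicator ?D z *\<^sub>R ?F z" for z
  proof (cases "z \<in> ?D - K")
    case True
    then have "z = snd c (chart_inv c z)" using hom by (auto simp: homeomorphism_def)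
    then have "\<rho> c (chart_inv c z) = 0"
      using True closure_subset[of "{x. \<rho> c x \<noteq> 0}"] unfolding K_def by blast
    then show ?thesis by simp
  next
    case False
    then show ?thesis using K(2) by (auto simp: indicator_def)
  qed
  ultimately show ?thesis unfolding set_integrable_def by (simp only:)
qed

text \<open>Integrability of each summand in each chart lets the integrals be split; the remaining
  step exchanges the sums over charts and over \<open>I\<close>.\<close>

lemma liouville_integral_sum:
  fixes \<A> :: "('a::{t2_space, second_countable_topology}, 'n::finite) chart set"
    and f :: "'i \<Rightarrow> 'a \<Rightarrow> complex"
  assumes "compact (UNIV :: 'a set)" "complex_atlas \<A>" "smooth_two_form \<A> \<omega>"
    and "\<And>i. i \<in> I \<Longrightarrow> continuous_on UNIV (f i)"
  shows "liouville_integral \<A> \<omega> (\<lambda>x. \<Sum>i\<in>I. a i * f i x) =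
    (\<Sum>i\<in>I. a i * liouville_integral \<A> \<omega> (f i))"
proof -
  \<comment> \<open>The chosen partition does not depend on the integrand, so all integrals in the
    statement use the same pair.\<close>
  obtain C \<rho> where P: "(SOME P. partition_of_unity \<A> P) = (C, \<rho>)" by fastforce
  then have C: "partition_of_unity \<A> (C, \<rho>)"
    using someI_ex[OF partition_of_unity_exists[OF assms(1,2)]] by simp
  define w where "w c z = \<rho> c (chart_inv c z) * liouville_density (\<omega> c z)" for c z
  have "(LINT z : snd c ` fst c | lborel. w c z *\<^sub>R (\<Sum>i\<in>I. a i * f i (chart_inv c z))) =
      (\<Sum>i\<in>I. a i * (LINT z : snd c ` fst c | lborel. w c z *\<^sub>R f i (chart_inv c z)))"
    if "c \<in> C" for c
  proof -
    let ?S = "\<lambda>z. indicator (snd c ` fst c) z :: real"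
    have int: "integrable lborel (\<lambda>z. ?S z *\<^sub>R (w c z *\<^sub>R f i (chart_inv c z)))" if "i \<in> I" for i
      using liouville_integrand_integrable[OF assms(1-3) C \<open>c \<in> C\<close> assms(4)[OF that]]
      unfolding set_integrable_def w_def .
    have "(\<lambda>z. ?S z *\<^sub>R (w c z *\<^sub>R (\<Sum>i\<in>I. a i * f i (chart_inv c z)))) =
        (\<lambda>z. \<Sum>i\<in>I. a i * (?S z *\<^sub>R (w c z *\<^sub>R f i (chart_inv c z))))"
      by (simp add: scaleR_sum_right)
    then have "(LINT z : snd c ` fst c | lborel. w c z *\<^sub>R (\<Sum>i\<in>I. a i * f i (chart_inv c z))) =
        (\<Sum>i\<in>I. LINT z | lborel. a i * (?S z *\<^sub>R (w c z *\<^sub>R f i (chart_inv c z))))"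
      unfolding set_lebesgue_integral_def
      by (simp only: Bochner_Integration.integral_sum integrable_mult_right[OF int])
    also have "\<dots> = (\<Sum>i\<in>I. a i * (LINT z : snd c ` fst c | lborel. w c z *\<^sub>R f i (chart_inv c z)))"
      unfolding set_lebesgue_integral_def by (simp only: integral_mult_right_zero)
    finally show ?thesis .
  qed
  then have "(\<Sum>c\<in>C. LINT z : snd c ` fst c | lborel. w c z *\<^sub>R (\<Sum>i\<in>I. a i * f i (chart_inv c z))) =
      (\<Sum>i\<in>I. a i * (\<Sum>c\<in>C. LINT z : snd c ` fst c | lborel. w c z *\<^sub>R f i (chart_inv c z)))"
    by (simp add: sum_distrib_left sum.swap[of _ C])
  then show ?thesis unfolding liouville_integral_def P w_def by simp
qed

section \<open>Holomorphic sections in local trivializations\<close>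

lemma trivialization:
  assumes "holomorphic_line_bundle \<A> L" "(V, t) \<in> trivs L" "x \<in> V"
  shows "bij_betw t (fibre L x) UNIV" "t (fzero L x) = 0"
    and "\<And>q r. q \<in> fibre L x \<Longrightarrow> r \<in> fibre L x \<Longrightarrow> t (fadd L q r) = t q + t r"
    and "\<And>q a. q \<in> fibre L x \<Longrightarrow> t (fscale L a q) = a * t q"
  using assms unfolding holomorphic_line_bundle_def by blast+

lemma trivialization_open:
  assumes "holomorphic_line_bundle \<A> L" "(V, t) \<in> trivs L"
  shows "open V"
  using assms unfolding holomorphic_line_bundle_def by fast

lemma trivialization_cover:
  assumes "holomorphic_line_bundle \<A> L"
  shows "(\<Union>b\<in>trivs L. fst b) = UNIV"
  using assms unfolding holomorphic_line_bundle_def by (elim conjE)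

lemma obtain_trivialization:
  assumes "holomorphic_line_bundle \<A> L"
  obtains V t where "(V, t) \<in> trivs L" "x \<in> V"
proof -
  have "x \<in> (\<Union>b\<in>trivs L. fst b)" by (simp add: trivialization_cover[OF assms])
  then show ?thesis using that by force
qed

lemma fibre_closed:
  assumes "holomorphic_line_bundle \<A> L"
  shows "fzero L x \<in> fibre L x"
    and "q \<in> fibre L x \<Longrightarrow> r \<in> fibre L x \<Longrightarrow> fadd L q r \<in> fibre L x"
    and "q \<in> fibre L x \<Longrightarrow> fscale L a q \<in> fibre L x"
  using assms unfolding holomorphic_line_bundle_def by (elim conjE, simp)+

lemma trivialization_eq_iff:
  assumes "holomorphic_line_bundle \<A> L" "(V, t) \<in> trivs L" "x \<in> V"
    and "q \<in> fibre L x" "r \<in> fibre L x"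
  shows "t q = t r \<longleftrightarrow> q = r"
  using trivialization(1)[OF assms(1-3)] assms(4,5) by (metis bij_betw_def inj_on_eq_iff)

lemma section_comb_fibre:
  assumes "holomorphic_line_bundle \<A> L" "\<And>j. j < k \<Longrightarrow> s j x \<in> fibre L x"
  shows "section_comb L c s k x \<in> fibre L x"
  using assms(2) by (induction k) (auto intro!: fibre_closed[OF assms(1)])

text \<open>The fibre operations are constrained by closure of the fibres and by linearity of the
  fibre coordinates. Applying a coordinate turns an abstract combination into a sum of complex
  numbers; the induction needs each partial combination to stay in the fibre.\<close>

lemma trivialization_section_comb:
  assumes "holomorphic_line_bundle \<A> L" "(V, t) \<in> trivs L" "x \<in> V"
    and "\<And>j. j < k \<Longrightarrow> s j x \<in> fibre L x"
  shows "t (section_comb L c s k x) = (\<Sum>j<k. c j * t (s j x))"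
  using assms(4)
proof (induction k)
  case (Suc k)
  then show ?case
    by (simp add: trivialization[OF assms(1-3)] section_comb_fibre[OF assms(1)]
        fibre_closed[OF assms(1)])
qed (simp add: trivialization[OF assms(1-3)])

section \<open>Holomorphic functions in coordinates and their transfer to the manifold\<close>

lemma cholomorphic_on_imp_continuous_on:
  assumes "cholomorphic_on f D"
  shows "continuous_on D f"
  using assms unfolding cholomorphic_on_def
  by (meson continuous_at_imp_continuous_on has_derivative_continuous)

lemma cholomorphic_on_sum:
  fixes f :: "'i \<Rightarrow> complex ^ 'n::finite \<Rightarrow> complex"
  assumes "\<And>i. i \<in> I \<Longrightarrow> cholomorphic_on (f i) D"
  shows "cholomorphic_on (\<lambda>z. \<Sum>i\<in>I. a i * f i z) D"
  unfolding cholomorphic_on_def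
proof
  fix z assume "z \<in> D"
  then have "\<forall>i\<in>I. \<exists>f'. (f i has_derivative f') (at z) \<and> (\<forall>c v. f' (c *s v) = c * f' v)"
    using assms unfolding cholomorphic_on_def by blast
  then obtain f' where f': "\<forall>i\<in>I. (f i has_derivative f' i) (at z) \<and>
      (\<forall>c v. f' i (c *s v) = c * f' i v)"
    by metis
  then have "((\<lambda>z. \<Sum>i\<in>I. a i * f i z) has_derivative (\<lambda>v. \<Sum>i\<in>I. a i * f' i v)) (at z)"
    by (intro has_derivative_sum has_derivative_mult_right) blast
  moreover have "(\<Sum>i\<in>I. a i * f' i (c *s v)) = c * (\<Sum>i\<in>I. a i * f' i v)" for c v
    using f' by (simp add: sum_distrib_left mult.left_commute)
  ultimately show "\<exists>f'. ((\<lambda>z. \<Sum>i\<in>I. a i * f i z) has_derivative f') (at z) \<and>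
      (\<forall>c v. f' (c *s v) = c * f' v)" by blast
qed

text \<open>Derivatives at \<open>z\<close> are taken in the full space, while \<open>f\<close> and
  \<open>g\<close> agree on \<open>D\<close> alone; openness of \<open>D\<close> makes them agree
  near \<open>z\<close>.\<close>

lemma cholomorphic_on_cong:
  fixes f g :: "complex ^ 'n::finite \<Rightarrow> complex"
  assumes "open D" "\<And>z. z \<in> D \<Longrightarrow> f z = g z" "cholomorphic_on f D"
  shows "cholomorphic_on g D"
  unfolding cholomorphic_on_def
proof
  fix z assume z: "z \<in> D"
  then obtain f' where f': "(f has_derivative f') (at z)" "\<forall>c v. f' (c *s v) = c * f' v"
    using assms(3) unfolding cholomorphic_on_def by blast
  have "(g has_derivative f') (at z)"
    by (rule has_derivative_transform_within_open[OF f'(1) assms(1) z assms(2)])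
  with f'(2) show "\<exists>f'. (g has_derivative f') (at z) \<and> (\<forall>c v. f' (c *s v) = c * f' v)"
    by blast
qed

lemma chart_image_open:
  fixes \<A> :: "('a::{t2_space, second_countable_topology}, 'n::finite) chart set"
  assumes "complex_atlas \<A>" "c \<in> \<A>" "open W"
  shows "open (snd c ` (fst c \<inter> W))"
proof -
  have "homeomorphism (fst c) (snd c ` fst c) (snd c) (chart_inv c)" "open (snd c ` fst c)"
    using assms(1,2) unfolding complex_atlas_def by blast+
  then show ?thesis
    using assms(3) homeomorphism_imp_open_map openin_open_Int openin_open_trans by metis
qed

text \<open>Regularity is given in coordinates only. On a chart domain \<open>f\<close> is its
  coordinate expression composed with the chart, and continuity is local on an open cover.\<close>

lemma continuous_on_chart_pullback:
  fixes \<A> :: "('a::{t2_space, second_countable_topology}, 'n::finite) chart set"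
    and f :: "'a \<Rightarrow> 'b::topological_space"
  assumes "complex_atlas \<A>" "open W"
    and "\<And>c. c \<in> \<A> \<Longrightarrow> continuous_on (snd c ` (fst c \<inter> W)) (\<lambda>z. f (chart_inv c z))"
  shows "continuous_on W f"
proof -
  have "continuous_on (fst c \<inter> W) f" if "c \<in> \<A>" for c
  proof -
    have hom: "homeomorphism (fst c) (snd c ` fst c) (snd c) (chart_inv c)"
      using assms(1) that unfolding complex_atlas_def by blast
    have "continuous_on (fst c \<inter> W) (\<lambda>x. f (chart_inv c (snd c x)))"
      using hom by (intro continuous_on_compose2[OF assms(3)[OF that]])
        (auto simp: homeomorphism_def intro: continuous_on_subset)
    then show ?thesis
      by (rule continuous_on_eq) (use hom in \<open>auto simp: homeomorphism_def\<close>)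
  qed
  moreover have "open (fst c \<inter> W)" if "c \<in> \<A>" for c
    using assms(1,2) that unfolding complex_atlas_def by blast
  ultimately have "continuous_on (\<Union>c\<in>\<A>. fst c \<inter> W) f"
    by (intro continuous_on_open_UN) auto
  moreover have "(\<Union>c\<in>\<A>. fst c \<inter> W) = W" using assms(1) unfolding complex_atlas_def by blast
  ultimately show ?thesis by simp
qed

text \<open>In a trivialization the combination becomes a complex linear combination of holomorphic
  functions. This identity holds over \<open>V\<close> only, hence the transfer on the open
  coordinate image of \<open>V\<close>.\<close>

lemma section_comb_hol:
  fixes \<A> :: "('a::{t2_space, second_countable_topology}, 'n::finite) chart set"
  assumes "complex_atlas \<A>" "holomorphic_line_bundle \<A> L"
    and "\<And>j. j < k \<Longrightarrow> s j \<in> hol_sections \<A> L"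
  shows "section_comb L c s k \<in> hol_sections \<A> L"
proof -
  have fib: "s j x \<in> fibre L x" if "j < k" for j x
    using assms(3)[OF that] unfolding hol_sections_def by blast
  have "mholomorphic_on \<A> (\<lambda>x. t (section_comb L c s k x)) V" if V: "(V, t) \<in> trivs L" for V t
    unfolding mholomorphic_on_def
  proof
    fix d assume d: "d \<in> \<A>"
    have "open V" by (rule trivialization_open[OF assms(2) V])
    show "cholomorphic_on (\<lambda>z. t (section_comb L c s k (chart_inv d z))) (snd d ` (fst d \<inter> V))"
    proof (rule cholomorphic_on_cong)
      show "open (snd d ` (fst d \<inter> V))" by (rule chart_image_open[OF assms(1) d \<open>open V\<close>])
      show "cholomorphic_on (\<lambda>z. \<Sum>j<k. c j * t (s j (chart_inv d z))) (snd d ` (fst d \<inter> V))"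
      proof (rule cholomorphic_on_sum)
        fix j assume "j \<in> {..<k}"
        then show "cholomorphic_on (\<lambda>z. t (s j (chart_inv d z))) (snd d ` (fst d \<inter> V))"
          using assms(3)[of j] V d unfolding hol_sections_def mholomorphic_on_def by blast
      qed
      fix z assume z: "z \<in> snd d ` (fst d \<inter> V)"
      have "homeomorphism (fst d) (snd d ` fst d) (snd d) (chart_inv d)"
        using assms(1) d unfolding complex_atlas_def by blast
      then have "chart_inv d z \<in> V" using z by (auto simp: homeomorphism_def)
      then show "(\<Sum>j<k. c j * t (s j (chart_inv d z))) = t (section_comb L c s k (chart_inv d z))"
        by (simp add: trivialization_section_comb[OF assms(2) V] fib)
    qed
  qed
  moreover have "section_comb L c s k x \<in> fibre L x" for x
    by (rule section_comb_fibre[OF assms(2) fib])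
  ultimately show ?thesis unfolding hol_sections_def by auto
qed

section \<open>Evaluation of sections\<close>

lemma L0_trivialization_nonzero:
  assumes "holomorphic_line_bundle \<A> L" "(V, t) \<in> trivs L" "bproj L q \<in> V" "q \<in> L0 L"
  shows "t q \<noteq> 0"
  using trivialization_eq_iff[OF assms(1-3), of q "fzero L (bproj L q)"]
    trivialization(2)[OF assms(1-3)] fibre_closed(1)[OF assms(1)] assms(4)
  by (auto simp: L0_def fibre_def)

text \<open>Both sides of the equation defining \<open>hat\<close> lie in one fibre and can be
  compared by their coordinates; since \<open>t q\<close> is nonzero, the unique solution is a
  quotient. Linearity of \<open>hat\<close> is then read off from the numerator.\<close>

lemma hat_trivialization:
  assumes "holomorphic_line_bundle \<A> L" "(V, t) \<in> trivs L" "bproj L q \<in> V" "q \<in> L0 L"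
    and "s (bproj L q) \<in> fibre L (bproj L q)"
  shows "hat L q s = t (s (bproj L q)) / t q"
proof -
  have q: "q \<in> fibre L (bproj L q)" by (simp add: fibre_def)
  have "s (bproj L q) = fscale L c q \<longleftrightarrow> c = t (s (bproj L q)) / t q" for c
    using trivialization_eq_iff[OF assms(1-3) assms(5) fibre_closed(3)[OF assms(1) q]]
      trivialization(4)[OF assms(1-3) q] L0_trivialization_nonzero[OF assms(1-4)]
    by (simp add: eq_divide_eq) metis
  then show ?thesis unfolding hat_def by simp
qed

lemma hat_section_comb:
  assumes "holomorphic_line_bundle \<A> L" "q \<in> L0 L"
    and "\<And>j x. j < k \<Longrightarrow> s j x \<in> fibre L x"
  shows "hat L q (section_comb L c s k) = (\<Sum>j<k. c j * hat L q (s j))"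
proof -
  obtain V t where V: "(V, t) \<in> trivs L" "bproj L q \<in> V"
    using obtain_trivialization[OF assms(1)] by metis
  show ?thesis
    by (simp add: hat_trivialization[OF assms(1) V assms(2)] section_comb_fibre[OF assms(1) assms(3)]
        assms(3) trivialization_section_comb[OF assms(1) V] sum_divide_distrib)
qed

section \<open>The scalar product of sections\<close>

lemma hermitian_metric_sesquilinear:
  assumes "hermitian_metric \<A> L h"
    and "q \<in> fibre L x" "r \<in> fibre L x"
  shows "r' \<in> fibre L x \<Longrightarrow> h q (fadd L r r') = h q r + h q r'"
    and "h q (fscale L c r) = c * h q r"
    and "h r q = cnj (h q r)"
  using assms unfolding hermitian_metric_def by blast+

text \<open>The frame vector spans the fibre, so sesquilinearity reduces \<open>h\<close> to its
  value on the frame. This links the fibrewise metric to the function whose smoothness is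
  assumed.\<close>

lemma hermitian_metric_local:
  assumes "holomorphic_line_bundle \<A> L" "hermitian_metric \<A> L h"
    and "(V, t) \<in> trivs L" "x \<in> V" "q \<in> fibre L x" "r \<in> fibre L x"
  shows "h q r = cnj (t q) * t r *
    complex_of_real (Re (h (local_frame L (V, t) x) (local_frame L (V, t) x)))"
proof -
  let ?e = "local_frame L (V, t) x"
  \<comment> \<open>Bijectivity of the fibre coordinate makes the definite description in
    \<open>local_frame\<close> meaningful.\<close>
  have "\<exists>!e. e \<in> fibre L x \<and> t e = 1"
    using trivialization(1)[OF assms(1,3,4)] unfolding bij_betw_def inj_on_def
    by (metis (no_types, opaque_lifting) UNIV_I imageE)
  from theI'[OF this] have e: "?e \<in> fibre L x" "t ?e = 1"
    unfolding local_frame_def snd_conv by blast+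
  have p: "p = fscale L (t p) ?e" if "p \<in> fibre L x" for p
    using trivialization_eq_iff[OF assms(1,3,4) that fibre_closed(3)[OF assms(1) e(1)]]
      trivialization(4)[OF assms(1,3,4) e(1)] e(2) by (metis mult.right_neutral)
  note herm = hermitian_metric_sesquilinear[OF assms(2)]
  have "h q r = t r * h q ?e"
    using p[OF assms(6)] herm(2)[OF assms(5) e(1)] by metis
  also have "h q ?e = cnj (h ?e q)" by (rule herm(3)[OF e(1) assms(5)])
  also have "h ?e q = t q * h ?e ?e"
    using p[OF assms(5)] herm(2)[OF e(1) e(1)] by metis
  \<comment> \<open>Hermitian symmetry makes the diagonal value real, so taking \<open>Re\<close>
    loses nothing.\<close>
  also have "h ?e ?e = complex_of_real (Re (h ?e ?e))"
    using herm(3)[OF e(1) e(1)] by (simp add: complex_eq_iff)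
  finally show ?thesis by simp
qed

text \<open>Supplies the continuity that termwise integration requires: over each trivialization the
  pairing is a product of continuous functions.\<close>

lemma continuous_on_metric_sections:
  fixes \<A> :: "('a::{t2_space, second_countable_topology}, 'n::finite) chart set"
  assumes "complex_atlas \<A>" "holomorphic_line_bundle \<A> L" "hermitian_metric \<A> L h"
    and "u \<in> hol_sections \<A> L" "v \<in> hol_sections \<A> L"
  shows "continuous_on UNIV (\<lambda>x. h (u x) (v x))"
proof -
  have "continuous_on V (\<lambda>x. h (u x) (v x))" if V: "(V, t) \<in> trivs L" "open V" for V t
  proof -
    let ?H = "\<lambda>x. Re (h (local_frame L (V, t) x) (local_frame L (V, t) x))"
    have sec: "continuous_on V (\<lambda>x. t (w x))" if "w \<in> hol_sections \<A> L" for w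
    proof (rule continuous_on_chart_pullback[OF assms(1) V(2)])
      show "continuous_on (snd c ` (fst c \<inter> V)) (\<lambda>z. t (w (chart_inv c z)))" if "c \<in> \<A>" for c
        using \<open>w \<in> hol_sections \<A> L\<close> V that unfolding hol_sections_def mholomorphic_on_def
        by (intro cholomorphic_on_imp_continuous_on) blast
    qed
    have "continuous_on V ?H"
    proof (rule continuous_on_chart_pullback[OF assms(1) V(2)])
      fix c assume "c \<in> \<A>"
      then have "smooth_on (local_metric L h c (V, t)) (snd c ` (fst c \<inter> fst (V, t)))"
        using assms(3) V(1) unfolding hermitian_metric_def by blast
      then have "Ck_on 0 (local_metric L h c (V, t)) (snd c ` (fst c \<inter> V))"
        unfolding smooth_on_def fst_conv by blast
      then show "continuous_on (snd c ` (fst c \<inter> V)) (\<lambda>z. ?H (chart_inv c z))"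
        by (simp add: local_metric_def[abs_def])
    qed
    then have "continuous_on V (\<lambda>x. cnj (t (u x)) * t (v x) * complex_of_real (?H x))"
      by (intro continuous_on_mult continuous_on_cnj continuous_on_of_real sec assms(4,5))
    then show ?thesis
    proof (rule continuous_on_eq)
      fix x assume "x \<in> V"
      moreover have "u x \<in> fibre L x" "v x \<in> fibre L x"
        using assms(4,5) unfolding hol_sections_def by blast+
      ultimately show "cnj (t (u x)) * t (v x) * complex_of_real (?H x) = h (u x) (v x)"
        using hermitian_metric_local[OF assms(2,3) V(1)] by metis
    qed
  qed
  then have "continuous_on (\<Union>b\<in>trivs L. fst b) (\<lambda>x. h (u x) (v x))"
    using trivialization_open[OF assms(2)] by (intro continuous_on_open_UN) auto
  then show ?thesis by (simp add: trivialization_cover[OF assms(2)])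
qed

text \<open>In the local formula \<open>h q r\<close> depends on \<open>r\<close> through the linear
  factor \<open>t r\<close>; this also covers the empty combination, the zero vector.\<close>

lemma metric_section_comb_right:
  assumes "holomorphic_line_bundle \<A> L" "hermitian_metric \<A> L h"
    and "q \<in> fibre L x" "\<And>j. j < k \<Longrightarrow> s j x \<in> fibre L x"
  shows "h q (section_comb L c s k x) = (\<Sum>j<k. c j * h q (s j x))"
proof -
  obtain V t where V: "(V, t) \<in> trivs L" "x \<in> V"
    using obtain_trivialization[OF assms(1)] by metis
  show ?thesis
    using assms(4)
    by (simp add: hermitian_metric_local[OF assms(1,2) V assms(3)] section_comb_fibre[OF assms(1)]
        trivialization_section_comb[OF assms(1) V] sum_distrib_left sum_distrib_right mult_ac)
qed

lemma metric_section_comb_left: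
  assumes "holomorphic_line_bundle \<A> L" "hermitian_metric \<A> L h"
    and "q \<in> fibre L x" "\<And>j. j < k \<Longrightarrow> s j x \<in> fibre L x"
  shows "h (section_comb L c s k x) q = (\<Sum>j<k. cnj (c j) * h (s j x) q)"
proof -
  have "h (section_comb L c s k x) q = cnj (h q (section_comb L c s k x))"
    by (rule hermitian_metric_sesquilinear(3)[OF assms(2,3)])
      (rule section_comb_fibre[OF assms(1)], rule assms(4))
  also have "\<dots> = (\<Sum>j<k. cnj (c j) * cnj (h q (s j x)))"
    by (subst metric_section_comb_right[OF assms(1-3)]) (simp_all add: assms(4))
  also have "\<dots> = (\<Sum>j<k. cnj (c j) * h (s j x) q)"
  proof (rule sum.cong)
    fix j assume "j \<in> {..<k}"
    then have "cnj (h q (s j x)) = h (s j x) q"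
      using hermitian_metric_sesquilinear(3)[OF assms(2,3)] assms(4) by simp
    then show "cnj (c j) * cnj (h q (s j x)) = cnj (c j) * h (s j x) q" by simp
  qed simp
  finally show ?thesis .
qed

text \<open>Pointwise sesquilinearity of \<open>h\<close> is integrated term by term.\<close>

lemma section_inner_comb:
  fixes \<A> :: "('a::{t2_space, second_countable_topology}, 'n::finite) chart set"
  assumes "compact (UNIV :: 'a set)" "complex_atlas \<A>" "smooth_two_form \<A> \<omega>"
    and "holomorphic_line_bundle \<A> L" "hermitian_metric \<A> L h"
    and "\<And>j. j < k \<Longrightarrow> s j \<in> hol_sections \<A> L" "u \<in> hol_sections \<A> L"
  shows "section_inner \<A> \<omega> h u (section_comb L c s k) = (\<Sum>j<k. c j * section_inner \<A> \<omega> h u (s j))"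
    and "section_inner \<A> \<omega> h (section_comb L c s k) u =
      (\<Sum>j<k. cnj (c j) * section_inner \<A> \<omega> h (s j) u)"
proof -
  have fib: "w x \<in> fibre L x" if "w \<in> hol_sections \<A> L" for w x
    using that unfolding hol_sections_def by blast
  have comb: "h (u x) (section_comb L c s k x) = (\<Sum>j<k. c j * h (u x) (s j x))"
    "h (section_comb L c s k x) (u x) = (\<Sum>j<k. cnj (c j) * h (s j x) (u x))" for x
    by (intro metric_section_comb_right[OF assms(4,5)] metric_section_comb_left[OF assms(4,5)]
        fib assms(6,7); assumption)+
  show "section_inner \<A> \<omega> h u (section_comb L c s k) = (\<Sum>j<k. c j * section_inner \<A> \<omega> h u (s j))"
    unfolding section_inner_def comb(1)
    by (rule liouville_integral_sum[OF assms(1-3)])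
      (simp add: continuous_on_metric_sections[OF assms(2,4,5,7)] assms(6))
  show "section_inner \<A> \<omega> h (section_comb L c s k) u =
      (\<Sum>j<k. cnj (c j) * section_inner \<A> \<omega> h (s j) u)"
    unfolding section_inner_def comb(2)
    by (rule liouville_integral_sum[OF assms(1-3)])
      (simp add: continuous_on_metric_sections[OF assms(2,4,5) _ assms(7)] assms(6))
qed

section \<open>Coherent vectors\<close>

text \<open>The Riesz representative of \<open>hat L q\<close> in an orthonormal basis. Its
  coefficients are conjugated because the product is conjugate linear in the first slot. The length
  is \<open>Suc N\<close> since the basis indices run from 0 to \<open>N\<close>.\<close>

lemma coherent_vector_eq:
  fixes \<A> :: "('a::{t2_space, second_countable_topology}, 'n::finite) chart set"
  assumes "compact (UNIV :: 'a set)" "kaehler_manifold \<A> \<omega>" "quantum_line_bundle \<A> \<omega> L h"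
    and "orthonormal_section_basis \<A> \<omega> L h N s" "q \<in> L0 L"
  defines "e \<equiv> section_comb L (\<lambda>j. cnj (hat L q (s j))) s (Suc N)"
  shows "coherent_vector \<A> \<omega> L h q = e" "e \<in> hol_sections \<A> L"
    and "\<And>u. u \<in> hol_sections \<A> L \<Longrightarrow> section_inner \<A> \<omega> h e u = hat L q u"
proof -
  have atlas: "complex_atlas \<A>" and form: "smooth_two_form \<A> \<omega>"
    using assms(2) unfolding kaehler_manifold_def by blast+
  have L: "holomorphic_line_bundle \<A> L" and h: "hermitian_metric \<A> L h"
    using assms(3) unfolding quantum_line_bundle_def by blast+
  have s: "s j \<in> hol_sections \<A> L" if "j < Suc N" for j
    using assms(4) that unfolding orthonormal_section_basis_def section_basis_def by auto
  have span: "\<exists>c. u = section_comb L c s (Suc N)" if "u \<in> hol_sections \<A> L" for u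
    using assms(4) that unfolding orthonormal_section_basis_def section_basis_def by blast
  have orth: "section_inner \<A> \<omega> h (s i) (s j) = (if i = j then 1 else 0)"
    if "i < Suc N" "j < Suc N" for i j
    using assms(4) that unfolding orthonormal_section_basis_def by auto
  have hol: "section_comb L c s (Suc N) \<in> hol_sections \<A> L" for c
    by (rule section_comb_hol[OF atlas L s])
  \<comment> \<open>By orthonormality, pairing with \<open>s j\<close> on the right recovers the
    conjugate of the \<open>j\<close>-th coefficient.\<close>
  have coeff: "section_inner \<A> \<omega> h (section_comb L c s (Suc N)) (s j) = cnj (c j)"
    if "j < Suc N" for c j
    by (subst section_inner_comb(2)[OF assms(1) atlas form L h s s[OF that]])
      (use that in \<open>auto simp: orth if_distrib sum.delta cong: if_cong simp del: sum.lessThan_Suc\<close>)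
  show e: "e \<in> hol_sections \<A> L" unfolding e_def by (rule hol)
  show rep: "section_inner \<A> \<omega> h e u = hat L q u" if u: "u \<in> hol_sections \<A> L" for u
  proof -
    obtain d where d: "u = section_comb L d s (Suc N)" using span[OF u] by blast
    have "section_inner \<A> \<omega> h e u = (\<Sum>j<Suc N. d j * section_inner \<A> \<omega> h e (s j))"
      unfolding d by (rule section_inner_comb(1)[OF assms(1) atlas form L h s e])
    \<comment> \<open>The coefficients of \<open>e\<close> are already conjugated, so
      \<open>coeff\<close> returns \<open>hat L q (s j)\<close> itself.\<close>
    also have "\<dots> = (\<Sum>j<Suc N. d j * hat L q (s j))"
      unfolding e_def by (intro sum.cong) (simp_all add: coeff del: section_comb.simps)
    also have "\<dots> = hat L q u"
      unfolding d using s by (intro hat_section_comb[OF L assms(5), symmetric])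
        (auto simp: hol_sections_def)
    finally show ?thesis .
  qed
  show "coherent_vector \<A> \<omega> L h q = e"
    unfolding coherent_vector_def
  proof (rule the_equality)
    show "e \<in> hol_sections \<A> L \<and> (\<forall>u\<in>hol_sections \<A> L. section_inner \<A> \<omega> h e u = hat L q u)"
      using e rep by blast
  next
    fix e' assume e': "e' \<in> hol_sections \<A> L \<and>
      (\<forall>u\<in>hol_sections \<A> L. section_inner \<A> \<omega> h e' u = hat L q u)"
    then obtain c where c: "e' = section_comb L c s (Suc N)" using span by blast
    \<comment> \<open>Uniqueness: testing a representing section on the basis determines its
      coefficients.\<close>
    have "c j = cnj (hat L q (s j))" if "j < Suc N" for j
    proof -
      have "cnj (c j) = hat L q (s j)" using e' s[OF that] coeff[OF that, of c] c by simp
      then show ?thesis by (metis complex_cnj_cnj)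
    qed
    \<comment> \<open>The coefficient sequences are known to agree below \<open>Suc N\<close> only,
      hence the bounded induction on \<open>k\<close>.\<close>
    then have "section_comb L c s k = section_comb L (\<lambda>j. cnj (hat L q (s j))) s k"
      if "k \<le> Suc N" for k
      using that by (induction k) auto
    then show "e' = e" unfolding c e_def by blast
  qed
qed

section \<open>The scalar product of two coherent vectors\<close>

theorem proposition4p3:
  fixes \<A> :: "('a::{t2_space, second_countable_topology}, 'n::finite) chart set"
    and \<omega> :: "('a, 'n) two_form"
    and L :: "('a, 'l) line_bundle"
    and h :: "'l \<Rightarrow> 'l \<Rightarrow> complex"
    and N :: nat
    and s :: "nat \<Rightarrow> 'a \<Rightarrow> 'l"
    and \<phi> :: "'l \<Rightarrow> nat \<Rightarrow> complex"
    and q q' :: 'l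
  assumes "compact (UNIV :: 'a set)"
    and "connected (UNIV :: 'a set)"
    and "kaehler_manifold \<A> \<omega>"
    and "quantum_line_bundle \<A> \<omega> L h"
    and "very_ample \<A> L"
    and "orthonormal_section_basis \<A> \<omega> L h N s"
    and "\<phi> = section_coords L N s"
    and "q \<in> L0 L"
    and "q' \<in> L0 L"
  shows "section_inner \<A> \<omega> h (coherent_vector \<A> \<omega> L h q) (coherent_vector \<A> \<omega> L h q') =
         cvec_inner N (\<phi> q') (\<phi> q)"
proof -
  have L: "holomorphic_line_bundle \<A> L"
    using assms(4) unfolding quantum_line_bundle_def by blast
  have s: "s j x \<in> fibre L x" if "j < Suc N" for j x
    using assms(6) that
    unfolding orthonormal_section_basis_def section_basis_def hol_sections_def by auto
  note e = coherent_vector_eq[OF assms(1,3,4,6)]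
  \<comment> \<open>The left vector evaluates at \<open>q\<close>, while the right one is expanded
    with conjugated values at \<open>q'\<close>; this is why \<open>q'\<close> lands in the
    conjugate linear slot of the standard product.\<close>
  have "section_inner \<A> \<omega> h (coherent_vector \<A> \<omega> L h q) (coherent_vector \<A> \<omega> L h q') =
      hat L q (section_comb L (\<lambda>j. cnj (hat L q' (s j))) s (Suc N))"
    unfolding e(1)[OF assms(8)] e(1)[OF assms(9)] by (rule e(3)[OF assms(8) e(2)[OF assms(9)]])
  also have "\<dots> = (\<Sum>j<Suc N. cnj (hat L q' (s j)) * hat L q (s j))"
    by (rule hat_section_comb[OF L assms(8) s])
  also have "\<dots> = cvec_inner N (\<phi> q') (\<phi> q)"
    unfolding cvec_inner_def assms(7) section_coords_def lessThan_Suc_atMost by simp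
  finally show ?thesis .
qed

end
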